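(* Let $0\le\mu\le L$ with $L>0$, and $L_{xy}\ge0$, and let $f:\mathbb{R}^{d_x}\times\mathbb{R}^{d_y}\to\mathbb{R}$ belong to $S_{\mu_x\mu_yL_xL_yL_{xy}}$ with $\mu_x=\mu_y=\mu$ and $L_x=L_y=L$. Let $\widetilde\nabla_xf,\widetilde\nabla_yf$ be inexact partial gradients of $f$ with relative error $\alpha\in[0,1)$, where $\alpha$ satisfies $$\alpha\left((1+\alpha)^2+\alpha\right)<\frac{\mu}{2L}-\frac{L_{xy}^2}{2L^2}\quad\text{in the case } L_{xy}^2\le\frac{\mu L}{2},$$ $$\alpha\left((1+\alpha)^2+\alpha\right)<\frac{\mu^2}{8L_{xy}^2}\quad\text{in the case } L_{xy}^2>\frac{\mu L}{2}.$$ Then with an appropriate choice of the step sizes $\eta_x,\eta_y>0$, Inexact Sim-GDA converges linearly to the saddle point of $f$.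
   Context: $f\in S_{\mu_x\mu_yL_xL_yL_{xy}}$ means: $f:\mathbb{R}^{d_x}\times\mathbb{R}^{d_y}\to\mathbb{R}$ is (continuously) differentiable, and for all $x,\widehat x,\widetilde x\in\mathbb{R}^{d_x}$, $y,\widehat y,\widetilde y\in\mathbb{R}^{d_y}$: $f(\cdot,y)$ is $\mu_x$-strongly convex; $f(x,\cdot)$ is $\mu_y$-strongly concave; $\|\nabla_xf(\widetilde x,y)-\nabla_xf(\widehat x,y)\|_2\le L_x\|\widetilde x-\widehat x\|_2$; $\|\nabla_xf(x,\widetilde y)-\nabla_xf(x,\widehat y)\|_2\le L_{xy}\|\widetilde y-\widehat y\|_2$; $\|\nabla_yf(x,\widetilde y)-\nabla_yf(x,\widehat y)\|_2\le L_y\|\widetilde y-\widehat y\|_2$; $\|\nabla_yf(\widetilde x,y)-\nabla_yf(\widehat x,y)\|_2\le L_{xy}\|\widetilde x-\widehat x\|_2$. The saddle point $z^*=(x^*,y^* )$ of $\min_x\max_yf(x,y)$ is the point where both partial gradients vanish (the hypotheses on $\alpha$ force $\mu>0$, so it is unique). Inexact partial gradients with relative error $\alpha$: maps $\widetilde\nabla_xf,\widetilde\nabla_yf$ such that for all $x,y$, $$\|\widetilde\nabla_xf(x,y)-\nabla_xf(x,y)\|_2^2+\|\widetilde\nabla_yf(x,y)-\nabla_yf(x,y)\|_2^2\le\alpha^2\left(\|\nabla_xf(x,y)\|_2^2+\|\nabla_yf(x,y)\|_2^2\right).$$ Inexact Sim-GDA with step sizes $\eta_x,\eta_y$, started from $z^0=(x^0,y^0)$: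 for $k=0,1,2,\dots$, $x^{k+1}=x^k-\eta_x\widetilde\nabla_xf(x^k,y^k)$, $y^{k+1}=y^k+\eta_y\widetilde\nabla_yf(x^k,y^k)$, and $z^k=(x^k,y^k)$. The method converges linearly (for given $f$, inexact gradients and step sizes) if there are $C>0$ and $\rho\in[0,1)$ such that for every starting point $z^0$ and all $k\ge0$, $\|z^k-z^*\|_2\le C\rho^k\|z^0-z^*\|_2$. *)

theory Defs
  imports "HOL-Analysis.Analysis"
begin

definition strongly_convex :: "real \<Rightarrow> ('a::real_inner \<Rightarrow> real) \<Rightarrow> bool" where
  "strongly_convex m g \<longleftrightarrow>
     (\<forall>u v. \<forall>t\<in>{0..1}.
        g (t *\<^sub>R u + (1 - t) *\<^sub>R v)
          \<le> t * g u + (1 - t) * g v - m / 2 * t * (1 - t) * (norm (u - v))\<^sup>2)"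

definition strongly_concave :: "real \<Rightarrow> ('a::real_inner \<Rightarrow> real) \<Rightarrow> bool" where
  "strongly_concave m g \<longleftrightarrow> strongly_convex m (\<lambda>u. - g u)"

definition continuously_differentiable :: "('a::real_inner \<Rightarrow> real) \<Rightarrow> bool" where
  "continuously_differentiable g \<longleftrightarrow>
     (\<exists>g'. (\<forall>z. GDERIV g z :> g' z) \<and> continuous_on UNIV g')"

(* The partial gradients are unspecified at points where the partial derivative
   does not exist; they are only used for differentiable f. *)

definition grad_x :: "((real ^ 'm) \<times> (real ^ 'n) \<Rightarrow> real) \<Rightarrow> (real ^ 'm) \<times> (real ^ 'n) \<Rightarrow> real ^ 'm" where
  "grad_x f z = (THE D. GDERIV (\<lambda>x. f (x, snd z)) (fst z) :> D)"

definition grad_y :: "((real ^ 'm) \<times> (real ^ 'n) \<Rightarrow> real) \<Rightarrow> (real ^ 'm) \<times> (real ^ 'n) \<Rightarrow> real ^ 'n" where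
  "grad_y f z = (THE D. GDERIV (\<lambda>y. f (fst z, y)) (snd z) :> D)"

definition S_class ::
  "real \<Rightarrow> real \<Rightarrow> real \<Rightarrow> real \<Rightarrow> real \<Rightarrow> ((real ^ 'm) \<times> (real ^ 'n) \<Rightarrow> real) set" where
  "S_class \<mu>x \<mu>y Lx Ly Lxy = {f.
     continuously_differentiable f \<and>
     (\<forall>y. strongly_convex \<mu>x (\<lambda>x. f (x, y))) \<and>
     (\<forall>x. strongly_concave \<mu>y (\<lambda>y. f (x, y))) \<and>
     (\<forall>x1 x2 y. norm (grad_x f (x1, y) - grad_x f (x2, y)) \<le> Lx * norm (x1 - x2)) \<and>
     (\<forall>x y1 y2. norm (grad_x f (x, y1) - grad_x f (x, y2)) \<le> Lxy * norm (y1 - y2)) \<and>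
     (\<forall>x y1 y2. norm (grad_y f (x, y1) - grad_y f (x, y2)) \<le> Ly * norm (y1 - y2)) \<and>
     (\<forall>x1 x2 y. norm (grad_y f (x1, y) - grad_y f (x2, y)) \<le> Lxy * norm (x1 - x2))}"

definition saddle_point :: "((real ^ 'm) \<times> (real ^ 'n) \<Rightarrow> real) \<Rightarrow> (real ^ 'm) \<times> (real ^ 'n) \<Rightarrow> bool" where
  "saddle_point f z \<longleftrightarrow> grad_x f z = 0 \<and> grad_y f z = 0"

definition inexact_partial_gradients ::
  "((real ^ 'm) \<times> (real ^ 'n) \<Rightarrow> real) \<Rightarrow> real \<Rightarrow>
   ((real ^ 'm) \<times> (real ^ 'n) \<Rightarrow> real ^ 'm) \<Rightarrow> ((real ^ 'm) \<times> (real ^ 'n) \<Rightarrow> real ^ 'n) \<Rightarrow> bool" where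
  "inexact_partial_gradients f \<alpha> gx gy \<longleftrightarrow>
     (\<forall>z. (norm (gx z - grad_x f z))\<^sup>2 + (norm (gy z - grad_y f z))\<^sup>2
            \<le> \<alpha>\<^sup>2 * ((norm (grad_x f z))\<^sup>2 + (norm (grad_y f z))\<^sup>2))"

primrec sim_gda ::
  "((real ^ 'm) \<times> (real ^ 'n) \<Rightarrow> real ^ 'm) \<Rightarrow> ((real ^ 'm) \<times> (real ^ 'n) \<Rightarrow> real ^ 'n) \<Rightarrow>
   real \<Rightarrow> real \<Rightarrow> (real ^ 'm) \<times> (real ^ 'n) \<Rightarrow> nat \<Rightarrow> (real ^ 'm) \<times> (real ^ 'n)" where
  "sim_gda gx gy \<eta>x \<eta>y z0 0 = z0"
| "sim_gda gx gy \<eta>x \<eta>y z0 (Suc k) =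
     (let z = sim_gda gx gy \<eta>x \<eta>y z0 k
      in (fst z - \<eta>x *\<^sub>R gx z, snd z + \<eta>y *\<^sub>R gy z))"

(* The norm on the product type is the Euclidean one,
   norm (x, y) = sqrt ((norm x)^2 + (norm y)^2). *)

definition sim_gda_converges_linearly ::
  "((real ^ 'm) \<times> (real ^ 'n) \<Rightarrow> real ^ 'm) \<Rightarrow> ((real ^ 'm) \<times> (real ^ 'n) \<Rightarrow> real ^ 'n) \<Rightarrow>
   real \<Rightarrow> real \<Rightarrow> (real ^ 'm) \<times> (real ^ 'n) \<Rightarrow> bool" where
  "sim_gda_converges_linearly gx gy \<eta>x \<eta>y zs \<longleftrightarrow>
     (\<exists>C>0. \<exists>\<rho>. 0 \<le> \<rho> \<and> \<rho> < 1 \<and>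
        (\<forall>z0 k. norm (sim_gda gx gy \<eta>x \<eta>y z0 k - zs) \<le> C * \<rho> ^ k * norm (z0 - zs)))"

end

theory Submission
  imports Defs
begin

text \<open>
  The operator \<open>F = (\<nabla>\<^sub>x f, - \<nabla>\<^sub>y f)\<close> is \<open>\<mu>\<close>-strongly monotone and \<open>M\<close>-Lipschitz with
  \<open>M = L + L\<^sub>x\<^sub>y\<close>, and Sim-GDA with equal step sizes \<open>\<eta>\<close> is the iteration \<open>z \<mapsto> z - \<eta> G z\<close> with
  \<open>\<parallel>G z - F z\<parallel> \<le> \<alpha> \<parallel>F z\<parallel>\<close>. Both hypotheses on \<open>\<alpha>\<close> imply \<open>\<alpha> M < \<mu>\<close>, and under this condition
  a small step contracts the distance to the zero of \<open>F\<close>. That zero exists because the exact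
  step is a contraction of the whole space.
\<close>

section \<open>First-order strong convexity and partial gradients\<close>

text \<open>The gap \<phi> between the two sides of the convexity inequality along the segment from
  \<open>v\<close> to \<open>u\<close> vanishes at 0 and is nonnegative on [0,1]. If the claim
  failed, its derivative at 0 would be negative.\<close>

lemma strongly_convex_first_order:
  fixes g :: "'a::real_inner \<Rightarrow> real"
  assumes cvx: "strongly_convex m g" and D: "GDERIV g v :> D"
  shows "g v + D \<bullet> (u - v) + m / 2 * (norm (u - v))\<^sup>2 \<le> g u"
proof (rule ccontr)
  assume neg: "\<not> ?thesis"
  define \<phi> where "\<phi> = (\<lambda>t. t * g u + (1 - t) * g v
      - m / 2 * t * (1 - t) * (norm (u - v))\<^sup>2 - g (v + t *\<^sub>R (u - v)))"
  \<comment> \<open>The unsimplified base point is the value of the inner map of the chain rule at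
    0, so that the composition rule applies directly.\<close>
  have D': "(g has_derivative (\<lambda>h. h \<bullet> D)) (at (v + 0 *\<^sub>R (u - v)))"
    using D by (simp add: gderiv_def)
  have "((\<lambda>t. g (v + t *\<^sub>R (u - v))) has_derivative (\<lambda>t. (t *\<^sub>R (u - v)) \<bullet> D)) (at 0)"
    by (rule has_derivative_compose[where f = "\<lambda>t. v + t *\<^sub>R (u - v)" and g = g, OF _ D'])
      (auto intro!: derivative_eq_intros)
  then have "((\<lambda>t. g (v + t *\<^sub>R (u - v))) has_field_derivative (D \<bullet> (u - v))) (at 0)"
    by (simp add: has_field_derivative_def inner_commute mult_commute_abs)
  then have "(\<phi> has_field_derivative
      (g u - g v - m / 2 * (norm (u - v))\<^sup>2 - D \<bullet> (u - v))) (at 0)"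
    unfolding \<phi>_def by (auto intro!: derivative_eq_intros)
  moreover have "g u - g v - m / 2 * (norm (u - v))\<^sup>2 - D \<bullet> (u - v) < 0"
    using neg by simp
  ultimately obtain d where d: "d > 0" "\<And>h. 0 < h \<Longrightarrow> h < d \<Longrightarrow> \<phi> (0 + h) < \<phi> 0"
    using DERIV_neg_dec_right by blast
  define t where "t = min (d / 2) 1"
  have t: "0 < t" "t < d" "t \<le> 1" using d(1) by (auto simp: t_def)
  have "t *\<^sub>R u + (1 - t) *\<^sub>R v = v + t *\<^sub>R (u - v)" by (simp add: algebra_simps)
  then have "0 \<le> \<phi> t"
    using cvx t unfolding strongly_convex_def \<phi>_def
    by (metis atLeastAtMost_iff diff_ge_0_iff_ge less_imp_le)
  moreover have "\<phi> 0 = 0" by (simp add: \<phi>_def)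
  ultimately show False using d(2)[of t] t by simp
qed

lemma GDERIV_unique:
  assumes "GDERIV g x :> D" and "GDERIV g x :> E"
  shows "D = E"
proof -
  have "(\<lambda>h. h \<bullet> D) = (\<lambda>h. h \<bullet> E)"
    using assms unfolding gderiv_def by (rule has_derivative_unique)
  then have "(D - E) \<bullet> (D - E) = 0"
    by (simp add: inner_diff_right fun_eq_iff)
  then show ?thesis by simp
qed

text \<open>Restricting the full derivative to the embedded x-space yields its first component;
  uniqueness of gradients then evaluates the definite description in \<open>grad_x\<close>.\<close>

lemma GDERIV_grad_x:
  fixes f :: "(real ^ 'm) \<times> (real ^ 'n) \<Rightarrow> real"
  assumes "continuously_differentiable f"
  shows "GDERIV (\<lambda>x. f (x, y)) x :> grad_x f (x, y)"
proof -
  obtain D where "GDERIV f (x, y) :> D"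
    using assms unfolding continuously_differentiable_def by blast
  then have D: "(f has_derivative (\<lambda>h. h \<bullet> D)) (at (x, y))"
    by (simp add: gderiv_def)
  have "((\<lambda>x. f (x, y)) has_derivative (\<lambda>h. (h, 0) \<bullet> D)) (at x)"
    by (rule has_derivative_compose[where f = "\<lambda>x. (x, y)" and g = f, OF _ D])
      (auto intro!: derivative_eq_intros)
  then have G: "GDERIV (\<lambda>x. f (x, y)) x :> fst D"
    by (simp add: gderiv_def inner_prod_def)
  then have "grad_x f (x, y) = fst D"
    unfolding grad_x_def fst_conv snd_conv
    by (rule the_equality) (rule GDERIV_unique[OF _ G])
  with G show ?thesis by simp
qed

lemma GDERIV_grad_y:
  fixes f :: "(real ^ 'm) \<times> (real ^ 'n) \<Rightarrow> real"
  assumes "continuously_differentiable f"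
  shows "GDERIV (\<lambda>y. f (x, y)) y :> grad_y f (x, y)"
proof -
  obtain D where "GDERIV f (x, y) :> D"
    using assms unfolding continuously_differentiable_def by blast
  then have D: "(f has_derivative (\<lambda>h. h \<bullet> D)) (at (x, y))"
    by (simp add: gderiv_def)
  have "((\<lambda>y. f (x, y)) has_derivative (\<lambda>h. (0, h) \<bullet> D)) (at y)"
    by (rule has_derivative_compose[where f = "\<lambda>y. (x, y)" and g = f, OF _ D])
      (auto intro!: derivative_eq_intros)
  then have G: "GDERIV (\<lambda>y. f (x, y)) y :> snd D"
    by (simp add: gderiv_def inner_prod_def)
  then have "grad_y f (x, y) = snd D"
    unfolding grad_y_def fst_conv snd_conv
    by (rule the_equality) (rule GDERIV_unique[OF _ G])
  with G show ?thesis by simp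
qed

section \<open>Monotonicity and Lipschitz constant of the saddle operator\<close>

definition saddle_operator ::
  "((real ^ 'm) \<times> (real ^ 'n) \<Rightarrow> real) \<Rightarrow> (real ^ 'm) \<times> (real ^ 'n) \<Rightarrow> (real ^ 'm) \<times> (real ^ 'n)"
  where "saddle_operator f z = (grad_x f z, - grad_y f z)"

lemma saddle_point_iff: "saddle_point f z \<longleftrightarrow> saddle_operator f z = 0"
  by (simp add: saddle_point_def saddle_operator_def zero_prod_def)

lemma norm_Pair_sq: "(norm (a, b))\<^sup>2 = (norm a)\<^sup>2 + (norm b)\<^sup>2"
  by (simp add: norm_Pair)

text \<open>Four first-order inequalities are added, one along each side of the rectangle with
  opposite corners \<open>z\<close> and \<open>w\<close>. The values of \<open>f\<close> at the
  corners cancel, and each squared side length collects \<mu>/2 twice.\<close>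

lemma saddle_operator_strongly_monotone:
  assumes f: "f \<in> S_class \<mu> \<mu> Lx Ly Lxy"
  shows "\<mu> * (norm (z - w))\<^sup>2 \<le> (saddle_operator f z - saddle_operator f w) \<bullet> (z - w)"
proof -
  obtain x1 y1 x2 y2 where zw: "z = (x1, y1)" "w = (x2, y2)" by fastforce
  have cd: "continuously_differentiable f"
    and cx: "\<And>y. strongly_convex \<mu> (\<lambda>x. f (x, y))"
    and cy: "\<And>x. strongly_convex \<mu> (\<lambda>y. - f (x, y))"
    using f by (auto simp: S_class_def strongly_concave_def)
  have X: "f (x, y) + grad_x f (x, y) \<bullet> (x' - x) + \<mu> / 2 * (norm (x' - x))\<^sup>2 \<le> f (x', y)" for x x' y
    by (rule strongly_convex_first_order[OF cx GDERIV_grad_x[OF cd]])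
  have Y: "- f (x, y) + - grad_y f (x, y) \<bullet> (y' - y) + \<mu> / 2 * (norm (y' - y))\<^sup>2 \<le> - f (x, y')" for x y y'
    by (rule strongly_convex_first_order[OF cy GDERIV_minus[OF GDERIV_grad_y[OF cd]]])
  have "(saddle_operator f z - saddle_operator f w) \<bullet> (z - w)
      = - (grad_x f z \<bullet> (x2 - x1)) - grad_x f w \<bullet> (x1 - x2)
        + grad_y f z \<bullet> (y2 - y1) + grad_y f w \<bullet> (y1 - y2)"
    by (simp add: zw saddle_operator_def inner_diff_left inner_diff_right)
  moreover have "(norm (z - w))\<^sup>2 = (norm (x1 - x2))\<^sup>2 + (norm (y1 - y2))\<^sup>2"
    by (simp add: zw norm_Pair_sq)
  moreover have "norm (x2 - x1) = norm (x1 - x2)" "norm (y2 - y1) = norm (y1 - y2)"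
    by (rule norm_minus_commute)+
  ultimately show ?thesis
    using X[of x1 y1 x2] X[of x2 y2 x1] Y[of x1 y1 y2] Y[of x2 y2 y1]
    by (simp add: zw distrib_left)
qed

text \<open>Passing through the corner \<open>(x2, y1)\<close> bounds the two components by the
  symmetric matrix with diagonal \<open>L\<close> and off-diagonal \<open>Lxy\<close> applied to
  \<open>(a, b)\<close>; its spectral norm is \<open>L + Lxy\<close>.\<close>

lemma saddle_operator_lipschitz:
  assumes f: "f \<in> S_class \<mu>x \<mu>y L L Lxy" and "0 \<le> L" "0 \<le> Lxy"
  shows "norm (saddle_operator f z - saddle_operator f w) \<le> (L + Lxy) * norm (z - w)"
proof -
  obtain x1 y1 x2 y2 where zw: "z = (x1, y1)" "w = (x2, y2)" by fastforce
  define a b where "a = norm (x1 - x2)" and "b = norm (y1 - y2)"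
  have Fx: "\<And>x y x'. norm (grad_x f (x, y) - grad_x f (x', y)) \<le> L * norm (x - x')"
    and Fxy: "\<And>x y y'. norm (grad_x f (x, y) - grad_x f (x, y')) \<le> Lxy * norm (y - y')"
    and Fy: "\<And>x y y'. norm (grad_y f (x, y) - grad_y f (x, y')) \<le> L * norm (y - y')"
    and Fyx: "\<And>x y x'. norm (grad_y f (x, y) - grad_y f (x', y)) \<le> Lxy * norm (x - x')"
    using f unfolding S_class_def by blast+
  have "norm (grad_x f z - grad_x f w)
      \<le> norm (grad_x f (x1, y1) - grad_x f (x2, y1)) + norm (grad_x f (x2, y1) - grad_x f (x2, y2))"
    unfolding zw by norm
  then have X: "norm (grad_x f z - grad_x f w) \<le> L * a + Lxy * b"
    using Fx[of x1 y1 x2] Fxy[of x2 y1 y2] unfolding a_def b_def by linarith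
  have "norm (grad_y f z - grad_y f w)
      \<le> norm (grad_y f (x1, y1) - grad_y f (x2, y1)) + norm (grad_y f (x2, y1) - grad_y f (x2, y2))"
    unfolding zw by norm
  then have Y: "norm (grad_y f z - grad_y f w) \<le> Lxy * a + L * b"
    using Fyx[of x1 y1 x2] Fy[of x2 y1 y2] unfolding a_def b_def by linarith
  have "(norm (saddle_operator f z - saddle_operator f w))\<^sup>2
      = (norm (grad_x f z - grad_x f w))\<^sup>2 + (norm (grad_y f z - grad_y f w))\<^sup>2"
    by (simp add: saddle_operator_def norm_Pair_sq norm_minus_commute)
  also have "\<dots> \<le> (L * a + Lxy * b)\<^sup>2 + (Lxy * a + L * b)\<^sup>2"
    by (intro add_mono power_mono X Y) auto
  also have "\<dots> = (L + Lxy)\<^sup>2 * (a\<^sup>2 + b\<^sup>2) - 2 * (L * Lxy) * (a - b)\<^sup>2"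
    by algebra
  also have "\<dots> \<le> (L + Lxy)\<^sup>2 * (a\<^sup>2 + b\<^sup>2)"
    using assms by simp
  also have "\<dots> = ((L + Lxy) * norm (z - w))\<^sup>2"
    by (simp add: zw a_def b_def norm_Pair_sq power_mult_distrib)
  finally show ?thesis
    by (rule power2_le_imp_le) (use assms in simp)
qed

section \<open>Contraction by perturbed steps\<close>

text \<open>Here \<open>d\<close> stands for the displacement from the zero, \<open>w\<close> for
  the exact operator value and \<open>v\<close> for the inexact one. By Cauchy-Schwarz the error
  costs at most \<open>\<alpha> * M\<close> of the monotonicity constant, and it enlarges the
  Lipschitz bound by the factor \<open>1 + \<alpha>\<close>.\<close>

lemma perturbed_step_bound:
  fixes d w v :: "'a::real_inner"
  assumes mono: "\<mu> * (norm d)\<^sup>2 \<le> w \<bullet> d" and lip: "norm w \<le> M * norm d"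
    and err: "norm (v - w) \<le> \<alpha> * norm w" and "0 \<le> \<alpha>" "0 \<le> M" "0 \<le> \<eta>"
  shows "(norm (d - \<eta> *\<^sub>R v))\<^sup>2
    \<le> (1 - 2 * \<eta> * (\<mu> - \<alpha> * M) + \<eta>\<^sup>2 * ((1 + \<alpha>) * M)\<^sup>2) * (norm d)\<^sup>2"
proof -
  have "\<alpha> * norm w \<le> \<alpha> * (M * norm d)"
    using lip \<open>0 \<le> \<alpha>\<close> by (rule mult_left_mono)
  then have vw: "norm (v - w) \<le> \<alpha> * M * norm d" using err by simp
  then have "norm v \<le> (1 + \<alpha>) * M * norm d"
    using lip norm_triangle_sub[of v w] by (simp add: algebra_simps)
  then have v2: "(norm v)\<^sup>2 \<le> ((1 + \<alpha>) * M)\<^sup>2 * (norm d)\<^sup>2"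
    by (metis norm_ge_zero power_mono power_mult_distrib)
  have "- ((v - w) \<bullet> d) \<le> norm (v - w) * norm d"
    using Cauchy_Schwarz_ineq2[of "v - w" d] by simp
  also have "\<dots> \<le> \<alpha> * M * norm d * norm d"
    by (rule mult_right_mono[OF vw]) simp
  finally have "- ((v - w) \<bullet> d) \<le> \<alpha> * M * (norm d)\<^sup>2"
    by (simp add: power2_eq_square algebra_simps)
  then have vd: "(\<mu> - \<alpha> * M) * (norm d)\<^sup>2 \<le> v \<bullet> d"
    using mono by (simp add: inner_diff_left algebra_simps)
  have "(norm (d - \<eta> *\<^sub>R v))\<^sup>2 = (norm d)\<^sup>2 - 2 * \<eta> * (v \<bullet> d) + \<eta>\<^sup>2 * (norm v)\<^sup>2"
    unfolding power2_norm_eq_inner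
    by (simp add: inner_diff_left inner_diff_right inner_commute power2_eq_square algebra_simps)
  also have "\<dots> \<le> (norm d)\<^sup>2 - 2 * \<eta> * ((\<mu> - \<alpha> * M) * (norm d)\<^sup>2)
      + \<eta>\<^sup>2 * (((1 + \<alpha>) * M)\<^sup>2 * (norm d)\<^sup>2)"
    using vd v2 \<open>0 \<le> \<eta>\<close> by (intro add_mono diff_mono mult_left_mono) auto
  finally show ?thesis by (simp add: algebra_simps)
qed

text \<open>The step size minimises the quadratic bound of the previous lemma.\<close>

lemma perturbed_step_contracts:
  fixes M \<mu> \<alpha> :: real
  assumes "\<alpha> * M < \<mu>" "\<mu> \<le> M" "0 \<le> \<alpha>" "0 < M"
  obtains \<eta> \<rho> where "0 < \<eta>" "0 \<le> \<rho>" "\<rho> < 1"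
    "\<And>d w v :: 'a::real_inner. \<lbrakk>\<mu> * (norm d)\<^sup>2 \<le> w \<bullet> d; norm w \<le> M * norm d;
       norm (v - w) \<le> \<alpha> * norm w\<rbrakk> \<Longrightarrow> norm (d - \<eta> *\<^sub>R v) \<le> \<rho> * norm d"
proof -
  define c K where "c = \<mu> - \<alpha> * M" and "K = (1 + \<alpha>) * M"
  have c: "0 < c" using assms by (simp add: c_def)
  have K: "0 < K" using assms by (simp add: K_def)
  have "0 \<le> \<alpha> * M" using assms by simp
  then have cK: "c \<le> K" using assms(2) unfolding c_def K_def distrib_right mult_1_left by linarith
  \<comment> \<open>\<open>q\<close> is the value of the quadratic bound at this step size.
    \<open>c \<le> K\<close> makes it nonnegative, so that its square root can serve as the rate;
    \<open>0 < c\<close> keeps it below 1.\<close>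
  define \<eta> q where "\<eta> = c / K\<^sup>2" and "q = 1 - (c / K)\<^sup>2"
  have "(c / K)\<^sup>2 \<le> 1" using c K cK by (simp add: power_le_one)
  moreover have "0 < (c / K)\<^sup>2" using c K by simp
  ultimately have q: "0 \<le> q" "q < 1" by (auto simp: q_def)
  have qeq: "1 - 2 * \<eta> * c + \<eta>\<^sup>2 * K\<^sup>2 = q"
    using K by (simp add: \<eta>_def q_def field_simps power2_eq_square)
  have \<eta>: "0 < \<eta>" using c K by (simp add: \<eta>_def)
  show ?thesis
  proof (rule that[OF \<eta>, of "sqrt q"])
    show "0 \<le> sqrt q" "sqrt q < 1" using q by auto
  next
    fix d w v :: 'a
    assume "\<mu> * (norm d)\<^sup>2 \<le> w \<bullet> d" "norm w \<le> M * norm d" "norm (v - w) \<le> \<alpha> * norm w"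
    then have "(norm (d - \<eta> *\<^sub>R v))\<^sup>2 \<le> q * (norm d)\<^sup>2"
      using perturbed_step_bound[of \<mu> d w M v \<alpha> \<eta>] assms \<eta> qeq by (simp add: c_def K_def)
    also have "\<dots> = (sqrt q * norm d)\<^sup>2" using q by (simp add: power_mult_distrib)
    finally show "norm (d - \<eta> *\<^sub>R v) \<le> sqrt q * norm d"
      by (rule power2_le_imp_le) (use q in simp)
  qed
qed

text \<open>Banach's fixed point theorem applies to the exact step \<open>T\<close>, whose fixed
  points are the zeros of \<open>F\<close> because \<eta> is nonzero.\<close>

lemma strongly_monotone_lipschitz_unique_zero:
  fixes F :: "'a::{real_inner, banach} \<Rightarrow> 'a"
  assumes mono: "\<And>z w. \<mu> * (norm (z - w))\<^sup>2 \<le> (F z - F w) \<bullet> (z - w)"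
    and lip: "\<And>z w. norm (F z - F w) \<le> M * norm (z - w)"
    and \<mu>: "0 < \<mu>" "\<mu> \<le> M"
  shows "\<exists>!z. F z = 0"
proof -
  \<comment> \<open>The error-free case \<alpha> = 0, where the smallness condition reduces to 0 <
    \<mu>.\<close>
  obtain \<eta> \<rho> where \<eta>: "0 < \<eta>" and \<rho>: "0 \<le> \<rho>" "\<rho> < 1"
    and contr: "\<And>d w v :: 'a. \<lbrakk>\<mu> * (norm d)\<^sup>2 \<le> w \<bullet> d; norm w \<le> M * norm d;
       norm (v - w) \<le> 0 * norm w\<rbrakk> \<Longrightarrow> norm (d - \<eta> *\<^sub>R v) \<le> \<rho> * norm d"
    using perturbed_step_contracts[where 'a='a and \<alpha>=0 and M=M and \<mu>=\<mu>] \<mu> by auto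
  define T where "T = (\<lambda>z. z - \<eta> *\<^sub>R F z)"
  have "dist (T z) (T w) \<le> \<rho> * dist z w" for z w
  proof -
    have "T z - T w = (z - w) - \<eta> *\<^sub>R (F z - F w)"
      by (simp add: T_def scaleR_diff_right)
    then show ?thesis
      using contr[OF mono[of z w] lip[of z w], of "F z - F w"] by (simp add: dist_norm)
  qed
  then have "\<exists>!z. T z = z"
    by (intro banach_fix_type[OF \<rho>]) auto
  then show ?thesis using \<eta> by (simp add: T_def)
qed

section \<open>Consequences of the bounds on the relative error\<close>

text \<open>The factor multiplying \<alpha> on the left is at least 1, so each hypothesis bounds
  \<alpha> itself. For weak coupling \<open>l \<le> L\<close> and
  \<open>2 * \<alpha> * L < \<mu>\<close>; for strong coupling
  \<open>\<alpha> * L < \<mu> / 4\<close> and \<open>\<alpha> * l \<le> \<mu> / 2\<close>.\<close>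

lemma error_times_lipschitz_less:
  fixes \<mu> L l \<alpha> :: real
  assumes "0 \<le> \<mu>" "\<mu> \<le> L" "0 < L" "0 \<le> l" "0 \<le> \<alpha>"
    and small: "l\<^sup>2 \<le> \<mu> * L / 2 \<Longrightarrow> \<alpha> * ((1 + \<alpha>)\<^sup>2 + \<alpha>) < \<mu> / (2 * L) - l\<^sup>2 / (2 * L\<^sup>2)"
    and large: "l\<^sup>2 > \<mu> * L / 2 \<Longrightarrow> \<alpha> * ((1 + \<alpha>)\<^sup>2 + \<alpha>) < \<mu>\<^sup>2 / (8 * l\<^sup>2)"
  shows "0 < \<mu>" and "\<alpha> * (L + l) < \<mu>"
proof -
  have "1 \<le> (1 + \<alpha>)\<^sup>2" using \<open>0 \<le> \<alpha>\<close> by (simp add: one_le_power)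
  then have "\<alpha> * 1 \<le> \<alpha> * ((1 + \<alpha>)\<^sup>2 + \<alpha>)"
    using \<open>0 \<le> \<alpha>\<close> by (intro mult_left_mono) linarith+
  then have \<alpha>: "\<alpha> \<le> \<alpha> * ((1 + \<alpha>)\<^sup>2 + \<alpha>)" by simp
  have "0 < \<mu> \<and> \<alpha> * (L + l) < \<mu>"
  proof (cases "l\<^sup>2 \<le> \<mu> * L / 2")
    case True
    have a: "\<alpha> < \<mu> / (2 * L) - l\<^sup>2 / (2 * L\<^sup>2)" using small[OF True] \<alpha> by linarith
    also have "\<dots> \<le> \<mu> / (2 * L)" by simp
    finally have aL: "\<alpha> * (2 * L) < \<mu>" using \<open>0 < L\<close> by (simp add: field_simps)
    then have "0 < \<mu>" using assms by (meson le_less_trans mult_nonneg_nonneg less_imp_le zero_le_numeral)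
    have "\<mu> * L \<le> L * L" using assms by (intro mult_right_mono) auto
    then have "l\<^sup>2 \<le> L\<^sup>2" using True zero_le_power2[of l] unfolding power2_eq_square by linarith
    then have "l \<le> L" by (rule power2_le_imp_le) (use assms in simp)
    then have "\<alpha> * (L + l) \<le> \<alpha> * (2 * L)" using assms by (intro mult_left_mono) auto
    then show ?thesis using aL \<open>0 < \<mu>\<close> by simp
  next
    case False
    then have l2: "\<mu> * L / 2 < l\<^sup>2" by simp
    moreover have "0 \<le> \<mu> * L" using assms by simp
    ultimately have "0 < l\<^sup>2" by linarith
    have "\<alpha> < \<mu>\<^sup>2 / (8 * l\<^sup>2)" using large[OF l2] \<alpha> by linarith
    then have a: "\<alpha> * (8 * l\<^sup>2) < \<mu>\<^sup>2" using \<open>0 < l\<^sup>2\<close> by (simp add: field_simps)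
    then have "0 < \<mu>\<^sup>2" using assms by (meson le_less_trans mult_nonneg_nonneg zero_le_numeral zero_le_power2)
    then have \<mu>: "0 < \<mu>" using assms by simp
    \<comment> \<open>The case condition trades the bound on \<open>\<alpha> * l\<^sup>2\<close> for
      one on \<open>\<alpha> * L\<close>, after cancelling \<mu>.\<close>
    have "\<alpha> * (8 * (\<mu> * L / 2)) \<le> \<alpha> * (8 * l\<^sup>2)" using l2 assms by (intro mult_left_mono) auto
    with a have "\<mu> * (\<alpha> * L * 4) < \<mu> * \<mu>" by (simp add: power2_eq_square algebra_simps)
    then have aL: "\<alpha> * L * 4 < \<mu>" using \<mu> by simp
    \<comment> \<open>If \<open>l \<le> L\<close>, the bound on \<open>\<alpha> * L\<close>
      suffices. Otherwise \<open>\<mu> \<le> L < l\<close>, so one factor \<open>l\<close> in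
      \<open>a\<close> can be lowered to \<mu> and cancelled.\<close>
    have "\<alpha> * l * 2 \<le> \<mu>"
    proof (cases "l \<le> L")
      case True
      then have "\<alpha> * l \<le> \<alpha> * L" using assms by (intro mult_left_mono)
      then show ?thesis using aL \<mu> by simp
    next
      case False
      then have "\<mu> * (\<alpha> * l * 8) \<le> l * (\<alpha> * l * 8)" using assms by (intro mult_right_mono) auto
      also have "\<dots> < \<mu> * \<mu>" using a by (simp add: power2_eq_square algebra_simps)
      finally have "\<alpha> * l * 8 < \<mu>" using \<mu> by simp
      then show ?thesis using \<mu> by simp
    qed
    then show ?thesis using aL \<mu> by (simp add: algebra_simps)
  qed
  then show "0 < \<mu>" and "\<alpha> * (L + l) < \<mu>" by auto
qed

section \<open>Linear convergence with equal step sizes\<close>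

theorem theorem13:
  fixes f :: "(real ^ 'm) \<times> (real ^ 'n) \<Rightarrow> real"
    and gx :: "(real ^ 'm) \<times> (real ^ 'n) \<Rightarrow> real ^ 'm"
    and gy :: "(real ^ 'm) \<times> (real ^ 'n) \<Rightarrow> real ^ 'n"
    and \<mu> L Lxy \<alpha> :: real
  assumes "0 \<le> \<mu>" and "\<mu> \<le> L" and "0 < L" and "0 \<le> Lxy"
    and "f \<in> S_class \<mu> \<mu> L L Lxy"
    and "0 \<le> \<alpha>" and "\<alpha> < 1"
    and "inexact_partial_gradients f \<alpha> gx gy"
    and "Lxy\<^sup>2 \<le> \<mu> * L / 2 \<Longrightarrow>
           \<alpha> * ((1 + \<alpha>)\<^sup>2 + \<alpha>) < \<mu> / (2 * L) - Lxy\<^sup>2 / (2 * L\<^sup>2)"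
    and "Lxy\<^sup>2 > \<mu> * L / 2 \<Longrightarrow>
           \<alpha> * ((1 + \<alpha>)\<^sup>2 + \<alpha>) < \<mu>\<^sup>2 / (8 * Lxy\<^sup>2)"
  shows "\<exists>zs. saddle_point f zs \<and> (\<forall>z. saddle_point f z \<longrightarrow> z = zs) \<and>
           (\<exists>\<eta>x>0. \<exists>\<eta>y>0. sim_gda_converges_linearly gx gy \<eta>x \<eta>y zs)"
proof -
  let ?M = "L + Lxy" and ?F = "saddle_operator f"
  note \<mu> = error_times_lipschitz_less[OF assms(1-4) \<open>0 \<le> \<alpha>\<close> assms(9,10)]
  have M: "\<mu> \<le> ?M" "0 < ?M" using assms by auto
  note mono = saddle_operator_strongly_monotone[OF assms(5)]
  have lip: "norm (?F z - ?F w) \<le> ?M * norm (z - w)" for z w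
    using saddle_operator_lipschitz assms by (metis less_imp_le)
  obtain zs where zs: "?F zs = 0" and uniq: "\<And>z. ?F z = 0 \<Longrightarrow> z = zs"
    using strongly_monotone_lipschitz_unique_zero[OF mono lip \<mu>(1) M(1)] by blast
  obtain \<eta> \<rho> where \<eta>: "0 < \<eta>" and \<rho>: "0 \<le> \<rho>" "\<rho> < 1"
    and contr: "\<And>d w v :: (real ^ 'm) \<times> (real ^ 'n). \<lbrakk>\<mu> * (norm d)\<^sup>2 \<le> w \<bullet> d;
       norm w \<le> ?M * norm d; norm (v - w) \<le> \<alpha> * norm w\<rbrakk> \<Longrightarrow> norm (d - \<eta> *\<^sub>R v) \<le> \<rho> * norm d"
    using perturbed_step_contracts[OF \<mu>(2) M(1) \<open>0 \<le> \<alpha>\<close> M(2)] by blast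
  \<comment> \<open>Changing the sign of the second component preserves the product norm, so the
    squared error condition carries over to the saddle operator.\<close>
  have err: "norm ((gx z, - gy z) - ?F z) \<le> \<alpha> * norm (?F z)" for z
  proof (rule power2_le_imp_le)
    show "(norm ((gx z, - gy z) - ?F z))\<^sup>2 \<le> (\<alpha> * norm (?F z))\<^sup>2"
      using assms(8)[unfolded inexact_partial_gradients_def, rule_format, of z]
      by (simp add: saddle_operator_def norm_Pair_sq power_mult_distrib norm_minus_commute)
  qed (use assms in simp)
  \<comment> \<open>Since \<open>?F zs = 0\<close>, monotonicity and the Lipschitz bound between
    \<open>z\<close> and \<open>zs\<close> become statements about \<open>?F z\<close> alone, as the
    contraction requires.\<close>
  have step: "norm (z - \<eta> *\<^sub>R (gx z, - gy z) - zs) \<le> \<rho> * norm (z - zs)" for z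
  proof -
    have "z - \<eta> *\<^sub>R (gx z, - gy z) - zs = (z - zs) - \<eta> *\<^sub>R (gx z, - gy z)"
      by (simp only: diff_diff_eq add.commute)
    then show ?thesis
      using contr[of "z - zs" "?F z" "(gx z, - gy z)"] mono[of z zs] lip[of z zs] err[of z]
      by (simp only: zs diff_zero)
  qed
  \<comment> \<open>Every step contracts by the same \<rho>, whatever the starting point, so C = 1
    works.\<close>
  have "norm (sim_gda gx gy \<eta> \<eta> z0 k - zs) \<le> 1 * \<rho> ^ k * norm (z0 - zs)" for z0 k
  proof (induction k)
    case (Suc k)
    let ?z = "sim_gda gx gy \<eta> \<eta> z0 k"
    have "sim_gda gx gy \<eta> \<eta> z0 (Suc k) = ?z - \<eta> *\<^sub>R (gx ?z, - gy ?z)"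
      by (simp add: Let_def prod_eq_iff)
    then have "norm (sim_gda gx gy \<eta> \<eta> z0 (Suc k) - zs) \<le> \<rho> * norm (?z - zs)"
      using step by simp
    also have "\<dots> \<le> \<rho> * (1 * \<rho> ^ k * norm (z0 - zs))"
      by (rule mult_left_mono[OF Suc.IH \<rho>(1)])
    finally show ?case by simp
  qed simp
  then have "sim_gda_converges_linearly gx gy \<eta> \<eta> zs"
    unfolding sim_gda_converges_linearly_def using \<rho> zero_less_one by blast
  then show ?thesis using zs uniq \<eta> unfolding saddle_point_iff by blast
qed

end
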